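(* Let $\{Q^i\}_{i\in I}$ be a (possibly infinite) family of covering polyhedra with bounds in $\mathbb{R}^n$ having all the same upper bounds, namely $Q^i=\{x\in\mathbb{R}^n_+\mid G(i)x\ge g(i),\ x\le u\}$ for all $i\in I$, where $G(i)\in\mathbb{R}^{m_i\times n}_+$ and $g(i)\in\mathbb{R}^{m_i}_+$. Then $$\bigcap_{i\in I}(Q^i+\mathbb{R}^n_+)=\Big(\bigcap_{i\in I}Q^i\Big)+\mathbb{R}^n_+ .$$
   Context: Each component of the upper bound vector $u$ is either a non-negative integer or $+\infty$ (in which case the bound imposes no constraint). $+$ denotes Minkowski sum. *)

theory Defs
  imports
    "Jordan_Normal_Form.Matrix"
    "HOL-Library.Extended_Real"
    "HOL-Library.Set_Algebras"
begin

text \<open>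
  The space $R^n$ is \<^term>\<open>carrier_vec n :: real vec set\<close>. The library's order on vectors and
  matrices is componentwise and requires equal dimensions; \<^term>\<open>A + B\<close> on sets is the
  Minkowski sum.
\<close>

definition nonneg_orthant :: "nat \<Rightarrow> real vec set" where
  "nonneg_orthant n = {x \<in> carrier_vec n. 0\<^sub>v n \<le> x}"

text \<open>
  Bounds are extended naturals, \<^term>\<open>\<infinity> :: enat\<close> meaning that the component is unbounded;
  the comparison of a real point with the bounds takes place in the extended reals.
\<close>

definition bounded_covering_polyhedron ::
    "nat \<Rightarrow> real mat \<Rightarrow> real vec \<Rightarrow> enat vec \<Rightarrow> real vec set" where
  "bounded_covering_polyhedron n G g u =
     {x \<in> nonneg_orthant n. G *\<^sub>v x \<ge> g \<and> map_vec ereal x \<le> map_vec ereal_of_enat u}"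

text \<open>
  Intersection of a family of subsets of $R^n$, taken inside $R^n$: the type \<^typ>\<open>real vec\<close>
  contains vectors of all dimensions, so the empty family would otherwise give too large a set.
\<close>

definition Inter_in :: "nat \<Rightarrow> 'i set \<Rightarrow> ('i \<Rightarrow> real vec set) \<Rightarrow> real vec set" where
  "Inter_in n I A = carrier_vec n \<inter> (\<Inter>i\<in>I. A i)"

end

theory Submission
  imports Defs
begin

text \<open>
  A point \<open>x\<close> of \<open>Q + R\<^sup>n\<^sub>+\<close> dominates some \<open>q \<in> Q\<close>. The truncation \<open>min x u\<close> still dominates
  \<open>q\<close>, so it satisfies the covering constraints (\<open>G \<ge> 0\<close>) and lies in \<open>Q\<close>. Since it depends
  only on \<open>x\<close> and \<open>u\<close>, it lies in all members of the family at once.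
\<close>

text \<open>The minimum is taken in the extended reals so that an infinite bound leaves the
  component of \<open>x\<close> unchanged.\<close>

definition truncate_vec :: "enat vec \<Rightarrow> real vec \<Rightarrow> real vec" where
  "truncate_vec u x =
     vec (dim_vec x) (\<lambda>j. real_of_ereal (min (ereal (x $ j)) (ereal_of_enat (u $ j))))"

lemma truncate_vec_carrier [simp]:
  "x \<in> carrier_vec n \<Longrightarrow> truncate_vec u x \<in> carrier_vec n"
  by (simp add: truncate_vec_def)

text \<open>One argument of the minimum is real and the other is never -\<infinity>, so the minimum
  is finite and \<open>real_of_ereal\<close> loses no information.\<close>

lemma ereal_truncate_vec:
  assumes "j < dim_vec x"
  shows "ereal (truncate_vec u x $ j) = min (ereal (x $ j)) (ereal_of_enat (u $ j))"
  using assms by (cases "u $ j") (auto simp: truncate_vec_def min_def)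

lemma truncate_vec_le: "truncate_vec u x \<le> x"
proof -
  have "truncate_vec u x $ j \<le> x $ j" if "j < dim_vec x" for j
    using ereal_truncate_vec[OF that, of u] by (metis ereal_less_eq(3) min.cobounded1)
  then show ?thesis
    by (simp add: less_eq_vec_def truncate_vec_def)
qed

lemma truncate_vec_le_bound:
  assumes "dim_vec u = dim_vec x"
  shows "map_vec ereal (truncate_vec u x) \<le> map_vec ereal_of_enat u"
proof -
  have [simp]: "dim_vec (truncate_vec u x) = dim_vec x"
    by (simp add: truncate_vec_def)
  show ?thesis
    using assms by (simp add: less_eq_vec_def ereal_truncate_vec)
qed

text \<open>Together with the two preceding bounds, this makes the truncation the greatest vector
  below both \<open>x\<close> and \<open>u\<close>.\<close>

lemma le_truncate_vec:
  assumes "q \<le> x" and "map_vec ereal q \<le> map_vec ereal_of_enat u"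
  shows "q \<le> truncate_vec u x"
proof -
  have "q $ j \<le> truncate_vec u x $ j" if "j < dim_vec x" for j
  proof -
    have "ereal (q $ j) \<le> ereal (truncate_vec u x $ j)"
      using assms that by (simp add: less_eq_vec_def ereal_truncate_vec)
    then show ?thesis
      by simp
  qed
  then show ?thesis
    using assms by (simp add: less_eq_vec_def truncate_vec_def)
qed

lemma mult_mat_vec_mono:
  fixes A :: "'a :: ordered_semiring_0 mat"
  assumes "A \<in> carrier_mat m n" and "0\<^sub>m m n \<le> A" and "v \<in> carrier_vec n" and "v \<le> w"
  shows "A *\<^sub>v v \<le> A *\<^sub>v w"
  using assms
  by (auto simp: less_eq_vec_def less_eq_mat_def scalar_prod_def intro!: sum_mono mult_left_mono)

lemma mem_nonneg_orthant_iff: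
  "x \<in> nonneg_orthant n \<longleftrightarrow> dim_vec x = n \<and> (\<forall>j<n. 0 \<le> x $ j)"
  unfolding nonneg_orthant_def less_eq_vec_def carrier_vec_def by (safe; simp)

text \<open>Adding the orthant is upward closure: the difference \<open>x - a\<close> is the
  required summand. Minkowski sums thereby become statements about the order alone.\<close>

lemma mem_plus_nonneg_orthant_iff:
  assumes "A \<subseteq> carrier_vec n"
  shows "x \<in> A + nonneg_orthant n \<longleftrightarrow> (\<exists>a\<in>A. a \<le> x)"
proof
  assume "x \<in> A + nonneg_orthant n"
  then obtain a r where "a \<in> A" and "r \<in> nonneg_orthant n" and "x = a + r"
    by (rule set_plus_elim)
  have "dim_vec r = n" and "\<And>j. j < n \<Longrightarrow> 0 \<le> r $ j"
    using \<open>r \<in> nonneg_orthant n\<close> by (auto simp: mem_nonneg_orthant_iff)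
  moreover have "dim_vec a = n"
    using assms \<open>a \<in> A\<close> by auto
  ultimately have "a \<le> x"
    by (simp add: less_eq_vec_def \<open>x = a + r\<close>)
  then show "\<exists>a\<in>A. a \<le> x"
    using \<open>a \<in> A\<close> by blast
next
  assume "\<exists>a\<in>A. a \<le> x"
  then obtain a where a: "a \<in> A" "a \<le> x"
    by blast
  then have dims: "dim_vec a = n" "dim_vec x = n"
    using assms by (auto simp: less_eq_vec_def)
  then have "x - a \<in> nonneg_orthant n"
    using a(2) by (simp add: mem_nonneg_orthant_iff less_eq_vec_def)
  moreover have "x = a + (x - a)"
    using dims by (intro eq_vecI) auto
  ultimately show "x \<in> A + nonneg_orthant n"
    using a by (metis set_plus_intro)
qed

lemma bounded_covering_polyhedron_carrier:
  "bounded_covering_polyhedron n G g u \<subseteq> carrier_vec n"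
  by (auto simp: bounded_covering_polyhedron_def nonneg_orthant_def)

text \<open>Nonnegativity and the covering constraints are preserved upwards, hence pass from
  \<open>q\<close> to the truncation; the upper bounds hold by construction.\<close>

lemma truncate_vec_in_bounded_covering_polyhedron:
  assumes G: "G \<in> carrier_mat m n" "0\<^sub>m m n \<le> G" and u: "u \<in> carrier_vec n"
    and q: "q \<in> bounded_covering_polyhedron n G g u" and "q \<le> x"
  shows "truncate_vec u x \<in> bounded_covering_polyhedron n G g u"
proof -
  have q': "q \<in> carrier_vec n" "0\<^sub>v n \<le> q" "g \<le> G *\<^sub>v q"
      "map_vec ereal q \<le> map_vec ereal_of_enat u"
    using q by (auto simp: bounded_covering_polyhedron_def nonneg_orthant_def)
  \<comment> \<open>The order on vectors requires equal dimensions, so \<open>x\<close> inherits its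
    dimension from \<open>q\<close>.\<close>
  then have x: "x \<in> carrier_vec n"
    using \<open>q \<le> x\<close> by (metis less_eq_vec_def carrier_vec_dim_vec carrier_vecD)
  have q_le: "q \<le> truncate_vec u x"
    using le_truncate_vec \<open>q \<le> x\<close> q' by blast
  have "g \<le> G *\<^sub>v truncate_vec u x"
    using q'(3) mult_mat_vec_mono[OF G q'(1) q_le] by (rule order_trans)
  moreover have "0\<^sub>v n \<le> truncate_vec u x"
    using q'(2) q_le by (rule order_trans)
  ultimately show ?thesis
    using x u truncate_vec_le_bound[of u x]
    by (simp add: bounded_covering_polyhedron_def nonneg_orthant_def)
qed

theorem proposition10:
  fixes n :: nat
    and I :: "'i set"
    and m :: "'i \<Rightarrow> nat"
    and G :: "'i \<Rightarrow> real mat"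
    and g :: "'i \<Rightarrow> real vec"
    and u :: "enat vec"
    and Q :: "'i \<Rightarrow> real vec set"
  assumes "\<And>i. i \<in> I \<Longrightarrow> G i \<in> carrier_mat (m i) n"
    and "\<And>i. i \<in> I \<Longrightarrow> G i \<ge> 0\<^sub>m (m i) n"
    and "\<And>i. i \<in> I \<Longrightarrow> g i \<in> carrier_vec (m i)"
    and "\<And>i. i \<in> I \<Longrightarrow> g i \<ge> 0\<^sub>v (m i)"
    and "u \<in> carrier_vec n"
    and "\<And>i. i \<in> I \<Longrightarrow> Q i = bounded_covering_polyhedron n (G i) (g i) u"
  shows "Inter_in n I (\<lambda>i. Q i + nonneg_orthant n) = Inter_in n I Q + nonneg_orthant n"
proof -
  have Q_carrier: "Q i \<subseteq> carrier_vec n" if "i \<in> I" for i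
    using assms(6)[OF that] bounded_covering_polyhedron_carrier by simp
  have "x \<in> Inter_in n I (\<lambda>i. Q i + nonneg_orthant n) \<longleftrightarrow> (\<exists>y\<in>Inter_in n I Q. y \<le> x)" for x
  proof
    assume "x \<in> Inter_in n I (\<lambda>i. Q i + nonneg_orthant n)"
    then have x: "x \<in> carrier_vec n" and dom: "\<And>i. i \<in> I \<Longrightarrow> \<exists>q\<in>Q i. q \<le> x"
      using mem_plus_nonneg_orthant_iff[OF Q_carrier] by (auto simp: Inter_in_def)
    \<comment> \<open>The dominated point \<open>q\<close> may vary with \<open>i\<close>, but the
      truncation does not: this is where the quantifiers over \<open>i\<close> and over the
      dominated point are exchanged.\<close>
    have "truncate_vec u x \<in> Q i" if "i \<in> I" for i
      using dom[OF that] assms(6)[OF that]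
        truncate_vec_in_bounded_covering_polyhedron[OF assms(1,2)[OF that] assms(5)] by auto
    then have "truncate_vec u x \<in> Inter_in n I Q"
      using x by (simp add: Inter_in_def)
    then show "\<exists>y\<in>Inter_in n I Q. y \<le> x"
      using truncate_vec_le by blast
  next
    assume "\<exists>y\<in>Inter_in n I Q. y \<le> x"
    then obtain y where y: "y \<in> carrier_vec n" "\<And>i. i \<in> I \<Longrightarrow> y \<in> Q i" "y \<le> x"
      by (auto simp: Inter_in_def)
    \<comment> \<open>This is derived from \<open>y\<close> rather than from some
      \<open>Q i\<close>, since \<open>I\<close> may be empty.\<close>
    have "x \<in> carrier_vec n"
      using y(1,3) by (metis less_eq_vec_def carrier_vec_dim_vec carrier_vecD)
    moreover have "x \<in> Q i + nonneg_orthant n" if "i \<in> I" for i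
      using mem_plus_nonneg_orthant_iff[OF Q_carrier[OF that]] y(2)[OF that] y(3) by blast
    ultimately show "x \<in> Inter_in n I (\<lambda>i. Q i + nonneg_orthant n)"
      by (simp add: Inter_in_def)
  qed
  \<comment> \<open>With this inclusion the upward-closure description also applies to the
    right-hand side of the goal.\<close>
  moreover have "Inter_in n I Q \<subseteq> carrier_vec n"
    by (simp add: Inter_in_def)
  ultimately show ?thesis
    by (simp add: set_eq_iff mem_plus_nonneg_orthant_iff)
qed

end
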